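(* Let $k\ge1$ be an integer and $\ell\ge1$ real. For any $0<\delta'\le1$ there is a $k$-service instance $(C,L,k,d,\ell)$ and a clustering $\mathcal{C}$ of $C$ such that, for every $\varepsilon$ and every execution of the algorithm List-k-service$(C,L,k,d,\ell,\varepsilon)$, every $k$-center-set $S$ in the output list satisfies $\Psi(S,\mathcal{C})\ge(3^{\ell}-\delta')\cdot\Psi^*(\mathcal{C})$; i.e. the algorithm does not provide better than a $(3^{\ell}-\delta')$ approximation guarantee.
   Context: A $k$-service instance: metric space $(\mathcal{X},d)$, finite facility locations $L\subseteq\mathcal{X}$, finite clients $C\subseteq\mathcal{X}$, integer $k>0$, real $\ell\ge1$. $\Phi(F,S)=\sum_{x\in S}\min_{f\in F}d^{\ell}(f,x)$. A $k$-center-set is a set of $k$ distinct elements of $L$; for a partition $\mathcal{C}=\{C_1,\dots,C_k\}$ of $C$, $\Psi(F,\mathcal{C})=\min_\pi\sum_i\sum_{x\in C_i}d^{\ell}(x,f_{\pi(i)})$ and $\Psi^*(\mathcal{C})=\min_F\Psi(F,\mathcal{C})$ over $k$-center-sets. Algorithm List-k-service$(C,L,k,d,\ell,\varepsilon)$: let $\beta=4^{\ell-1}(\ell^{\ell}3^{\ell^2+4\ell+3}/\varepsilon^{\ell+1}+1)$, $\gamma=\ell^{\ell}3^{\ell^2+5\ell+1}/\varepsilon^{\ell}$, $\eta=\alpha\beta\gamma k\,3^{\ell+2}/\varepsilon^2$. (1) Run any $\alpha$-approximation algorithm for the unconstrained $k$-service instance with both clients and candidate centers equal to $C$, obtaining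 $F\subseteq C$. (2) $\mathcal{L}\leftarrow\emptyset$. (3) Repeat $2^k$ times: sample a multiset $M$ of $\eta k$ points from $C$ independently by $D^{\ell}$-sampling w.r.t. $F$ (point $x$ chosen with probability $\Phi(F,\{x\})/\Phi(F,C)$); set $M\leftarrow M\cup F$; let $T$ be the union over $x\in M$ of the $k$ points of $L$ closest to $x$; add every $k$-element subset of $T$ to $\mathcal{L}$. (4) Return $\mathcal{L}$. *)

theory Defs
  imports "HOL-Probability.Probability"
begin

text \<open>Metric spaces are carrier-based (\<^locale>\<open>Metric_space\<close>), so that a statement can assert the
  existence of one; the carrier is \<open>X\<close>, the clients are \<open>C\<close>, the facility locations \<open>L\<close>.\<close>

definition center_sets :: "nat \<Rightarrow> 'a set \<Rightarrow> 'a set set" where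
  "center_sets k L = {F. F \<subseteq> L \<and> card F = k}"

text \<open>The cardinality bounds say that \<open>k\<close>-center-sets exist both in \<open>L\<close> and, for the
  instance with candidate centers \<open>C\<close> solved in the first step of the algorithm, in \<open>C\<close>.\<close>

definition k_service_instance ::
    "'a set \<Rightarrow> ('a \<Rightarrow> 'a \<Rightarrow> real) \<Rightarrow> 'a set \<Rightarrow> 'a set \<Rightarrow> nat \<Rightarrow> real \<Rightarrow> bool" where
  "k_service_instance X d C L k l \<longleftrightarrow>
     Metric_space X d \<and> L \<subseteq> X \<and> finite L \<and> C \<subseteq> X \<and> finite C \<and>
     0 < k \<and> k \<le> card L \<and> k \<le> card C \<and> 1 \<le> l"

definition Phi :: "('a \<Rightarrow> 'a \<Rightarrow> real) \<Rightarrow> real \<Rightarrow> 'a set \<Rightarrow> 'a set \<Rightarrow> real" where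
  "Phi d l F S = (\<Sum>x\<in>S. Min ((\<lambda>f. d f x powr l) ` F))"

text \<open>A clustering is a partition \<open>P\<close> of \<open>C\<close> into \<open>k\<close> parts; the permutations \<open>\<pi>\<close> matching
  \<open>C\<^sub>1, \<dots>, C\<^sub>k\<close> with \<open>f\<^sub>1, \<dots>, f\<^sub>k\<close> become the bijections from \<open>P\<close> to \<open>F\<close>.\<close>

definition Psi :: "('a \<Rightarrow> 'a \<Rightarrow> real) \<Rightarrow> real \<Rightarrow> 'a set \<Rightarrow> 'a set set \<Rightarrow> real" where
  "Psi d l F P =
     Min ((\<lambda>\<pi>. \<Sum>A\<in>P. \<Sum>x\<in>A. d x (\<pi> A) powr l) ` {\<pi> \<in> P \<rightarrow>\<^sub>E F. bij_betw \<pi> P F})"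

definition Psi_opt ::
    "('a \<Rightarrow> 'a \<Rightarrow> real) \<Rightarrow> real \<Rightarrow> nat \<Rightarrow> 'a set \<Rightarrow> 'a set set \<Rightarrow> real" where
  "Psi_opt d l k L P = Min ((\<lambda>F. Psi d l F P) ` center_sets k L)"

definition beta :: "real \<Rightarrow> real \<Rightarrow> real" where
  "beta l \<epsilon> = 4 powr (l - 1) *
     (l powr l * 3 powr (l\<^sup>2 + 4 * l + 3) / \<epsilon> powr (l + 1) + 1)"

definition gamma :: "real \<Rightarrow> real \<Rightarrow> real" where
  "gamma l \<epsilon> = l powr l * 3 powr (l\<^sup>2 + 5 * l + 1) / \<epsilon> powr l"

definition eta :: "real \<Rightarrow> nat \<Rightarrow> real \<Rightarrow> real \<Rightarrow> real" where
  "eta \<alpha> k l \<epsilon> = \<alpha> * beta l \<epsilon> * gamma l \<epsilon> * real k * 3 powr (l + 2) / \<epsilon>\<^sup>2"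

text \<open>The possible results \<open>F\<close> of an \<open>\<alpha>\<close>-approximation algorithm for unconstrained \<open>k\<close>-service
  in which \<open>C\<close> is both the set of clients and the set of candidate centers.\<close>

definition approx_centers ::
    "real \<Rightarrow> ('a \<Rightarrow> 'a \<Rightarrow> real) \<Rightarrow> 'a set \<Rightarrow> nat \<Rightarrow> real \<Rightarrow> 'a set \<Rightarrow> bool" where
  "approx_centers \<alpha> d C k l F \<longleftrightarrow>
     F \<in> center_sets k C \<and>
     Phi d l F C \<le> \<alpha> * Min ((\<lambda>G. Phi d l G C) ` center_sets k C)"

text \<open>If \<open>Phi d l F C = 0\<close>, the quotients below are meaningless; the convention is then to
  sample uniformly.\<close>

definition D_sampling ::
    "('a \<Rightarrow> 'a \<Rightarrow> real) \<Rightarrow> real \<Rightarrow> 'a set \<Rightarrow> 'a set \<Rightarrow> 'a pmf" where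
  "D_sampling d l C F =
     (if Phi d l F C = 0 then pmf_of_set C
      else embed_pmf (\<lambda>x. if x \<in> C then Phi d l F {x} / Phi d l F C else 0))"

lemma Phi_nonneg:
  assumes "finite F" "F \<noteq> {}"
  shows "0 \<le> Phi d l F S"
  unfolding Phi_def using assms by (intro sum_nonneg) auto

lemma pmf_D_sampling:
  assumes "finite C" "finite F" "F \<noteq> {}" "Phi d l F C \<noteq> 0"
  shows "pmf (D_sampling d l C F) x = (if x \<in> C then Phi d l F {x} / Phi d l F C else 0)"
proof -
  let ?g = "\<lambda>x. if x \<in> C then Phi d l F {x} / Phi d l F C else 0"
  have nn: "0 \<le> ?g y" for y
    using Phi_nonneg[OF assms(2,3), of d l] by auto
  have "(\<integral>\<^sup>+y. ennreal (?g y) \<partial>count_space UNIV) = (\<Sum>y\<in>C. ennreal (?g y))"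
    by (rule nn_integral_count_space') (use assms(1) in auto)
  also have "\<dots> = ennreal (\<Sum>y\<in>C. ?g y)"
    by (rule sum_ennreal) (rule nn)
  also have "(\<Sum>y\<in>C. ?g y) = (\<Sum>y\<in>C. Phi d l F {y}) / Phi d l F C"
    by (simp add: sum_divide_distrib)
  also have "(\<Sum>y\<in>C. Phi d l F {y}) = Phi d l F C"
    by (simp add: Phi_def)
  finally have "(\<integral>\<^sup>+y. ennreal (?g y) \<partial>count_space UNIV) = 1"
    using assms(4) by simp
  from pmf_embed_pmf[OF nn this] show ?thesis
    using assms(4) by (simp add: D_sampling_def)
qed

text \<open>Ties are possible, so ``the \<open>k\<close> points of \<open>L\<close> closest to \<open>x\<close>'' is a relation.\<close>

definition k_closest :: "('a \<Rightarrow> 'a \<Rightarrow> real) \<Rightarrow> 'a set \<Rightarrow> nat \<Rightarrow> 'a \<Rightarrow> 'a set \<Rightarrow> bool" where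
  "k_closest d L k x N \<longleftrightarrow>
     N \<in> center_sets k L \<and> (\<forall>a\<in>N. \<forall>b\<in>L - N. d x a \<le> d x b)"

text \<open>An outcome of one round: some multiset \<open>M\<close> of positive probability is drawn, ties
  are broken in some way (by \<open>N\<close>), and \<open>R\<close> is the resulting set of candidates. The number
  of samples \<open>\<eta>k\<close> is rounded up.\<close>

definition round_outcome ::
    "real \<Rightarrow> ('a \<Rightarrow> 'a \<Rightarrow> real) \<Rightarrow> 'a set \<Rightarrow> 'a set \<Rightarrow> nat \<Rightarrow> real \<Rightarrow> real \<Rightarrow> 'a set
      \<Rightarrow> 'a set set \<Rightarrow> bool" where
  "round_outcome \<alpha> d C L k l \<epsilon> F R \<longleftrightarrow>
     (\<exists>M N. M \<in> set_pmf (map_pmf mset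
                (replicate_pmf (nat \<lceil>eta \<alpha> k l \<epsilon> * real k\<rceil>) (D_sampling d l C F))) \<and>
            (\<forall>x \<in> set_mset M \<union> F. k_closest d L k x (N x)) \<and>
            R = center_sets k (\<Union>x \<in> set_mset M \<union> F. N x))"

text \<open>\<open>list_k_service \<alpha> d C L k l \<epsilon> \<L>\<close>: some execution of the algorithm returns \<open>\<L>\<close>.
  The entries of \<open>Rs\<close> are the candidates contributed by the successive rounds.\<close>

definition list_k_service ::
    "real \<Rightarrow> ('a \<Rightarrow> 'a \<Rightarrow> real) \<Rightarrow> 'a set \<Rightarrow> 'a set \<Rightarrow> nat \<Rightarrow> real \<Rightarrow> real
      \<Rightarrow> 'a set set \<Rightarrow> bool" where
  "list_k_service \<alpha> d C L k l \<epsilon> \<L> \<longleftrightarrow>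
     (\<exists>F Rs. approx_centers \<alpha> d C k l F \<and> length Rs = 2 ^ k \<and>
             (\<forall>R\<in>set Rs. round_outcome \<alpha> d C L k l \<epsilon> F R) \<and> \<L> = \<Union>(set Rs))"

lemma finite_center_sets: "finite L \<Longrightarrow> finite (center_sets k L)"
  by (simp add: center_sets_def)

lemma center_sets_nonempty: "k \<le> card L \<Longrightarrow> center_sets k L \<noteq> {}"
  unfolding center_sets_def using obtain_subset_with_card_n by blast

lemma k_closest_exists:
  assumes "finite L" "k \<le> card L"
  shows "\<exists>N. k_closest d L k x N"
  using assms(2)
proof (induction k)
  case 0
  show ?case by (rule exI[of _ "{}"]) (simp add: k_closest_def center_sets_def)
next
  case (Suc k)
  then obtain N where N: "k_closest d L k x N" by auto
  then have sub: "N \<subseteq> L" "card N = k" and le: "\<And>a b. a \<in> N \<Longrightarrow> b \<in> L - N \<Longrightarrow> d x a \<le> d x b"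
    by (auto simp: k_closest_def center_sets_def)
  have fin: "finite N" "finite (L - N)" using sub assms(1) finite_subset by auto
  have ne: "L - N \<noteq> {}" using Suc.prems sub fin card_mono[of N L] by auto
  obtain b where b: "b \<in> L - N" "\<And>c. c \<in> L - N \<Longrightarrow> d x b \<le> d x c"
    using ex_is_arg_min_if_finite[OF fin(2) ne, of "d x"] by (auto simp: is_arg_min_linorder)
  have "k_closest d L (Suc k) x (insert b N)"
    unfolding k_closest_def center_sets_def using sub fin b le by auto
  then show ?case ..
qed

text \<open>The algorithm can always be executed, so quantifying over its executions is not vacuous.\<close>

lemma list_k_service_exists:
  assumes inst: "k_service_instance X d C L k l" and "1 \<le> \<alpha>"
  shows "\<exists>\<L>. list_k_service \<alpha> d C L k l \<epsilon> \<L> \<and> \<L> \<noteq> {}"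
proof -
  have fin: "finite C" "finite L" and k: "0 < k" "k \<le> card L" "k \<le> card C"
    using inst by (auto simp: k_service_instance_def)
  have I: "finite ((\<lambda>G. Phi d l G C) ` center_sets k C)"
    "(\<lambda>G. Phi d l G C) ` center_sets k C \<noteq> {}"
    using fin k by (auto simp: finite_center_sets center_sets_nonempty)
  from Min_in[OF I] obtain F where F: "F \<in> center_sets k C"
    "Min ((\<lambda>G. Phi d l G C) ` center_sets k C) = Phi d l F C" by auto
  have Fne: "finite F" "F \<noteq> {}"
    using F(1) k fin by (auto simp: center_sets_def intro: finite_subset)
  have "1 * Phi d l F C \<le> \<alpha> * Phi d l F C"
    using Phi_nonneg[OF Fne, of d l C] \<open>1 \<le> \<alpha>\<close> by (intro mult_right_mono) auto
  then have app: "approx_centers \<alpha> d C k l F"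
    using F by (simp add: approx_centers_def)
  obtain M where M: "M \<in> set_pmf (map_pmf mset
      (replicate_pmf (nat \<lceil>eta \<alpha> k l \<epsilon> * real k\<rceil>) (D_sampling d l C F)))"
    using set_pmf_not_empty by fast
  define N where "N x = (SOME S. k_closest d L k x S)" for x
  have N: "k_closest d L k x (N x)" for x
    unfolding N_def by (rule someI_ex) (rule k_closest_exists[OF fin(2) k(2)])
  define R where "R = center_sets k (\<Union>x \<in> set_mset M \<union> F. N x)"
  have R: "round_outcome \<alpha> d C L k l \<epsilon> F R"
    unfolding round_outcome_def R_def using M N by blast
  obtain f where f: "f \<in> F" using Fne by auto
  have "N f \<in> R"
    using N[of f] f by (auto simp: R_def k_closest_def center_sets_def)
  moreover have "list_k_service \<alpha> d C L k l \<epsilon> R"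
    unfolding list_k_service_def
    by (rule exI[of _ F], rule exI[of _ "replicate (2 ^ k) R"]) (use app R in auto)
  ultimately show ?thesis by auto
qed

end

theory Submission
  imports Defs
begin

text \<open>Put \<open>N\<close> clients at pairwise distance 2, give each client \<open>k\<close> private facilities at
  distance 1, and add \<open>k\<close> central facilities at distance \<open>1 + s\<close> from all clients. The \<open>k\<close>
  facilities closest to a client are its private ones, so the algorithm never sees a central
  facility. A private facility has distance 3 from every client but its owner, so for any
  clustering a listed center set costs at least \<open>(N - k) 3\<^sup>l\<close>, while the central facilities
  cost \<open>N (1 + s)\<^sup>l\<close>. Let \<open>s \<rightarrow> 0\<close> and \<open>N \<rightarrow> \<infinity>\<close>.\<close>

section \<open>Cost of matching a center set to a clustering\<close>

lemma Psi_eqE: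
  assumes "finite P" "finite F" "card P = card F"
  obtains \<pi> where "bij_betw \<pi> P F"
    and "Psi d l F P = (\<Sum>A\<in>P. \<Sum>x\<in>A. d x (\<pi> A) powr l)"
proof -
  let ?B = "{\<pi> \<in> P \<rightarrow>\<^sub>E F. bij_betw \<pi> P F}"
  obtain h where h: "bij_betw h P F"
    using finite_same_card_bij[OF assms] by blast
  \<comment> \<open>\<open>Psi\<close> ranges over extensional functions, so that finitely many
    bijections compete; hence the restriction.\<close>
  then have "restrict h P \<in> ?B"
    by (auto simp: bij_betw_def image_restrict_eq inj_on_def)
  then have "?B \<noteq> {}" by blast
  moreover have "finite ?B"
    using assms by (simp add: finite_PiE)
  ultimately have "Psi d l F P \<in> (\<lambda>\<pi>. \<Sum>A\<in>P. \<Sum>x\<in>A. d x (\<pi> A) powr l) ` ?B"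
    unfolding Psi_def by (intro Min_in) auto
  then show ?thesis using that by auto
qed

text \<open>Under any bijection each part is served by one center, which is near at most one client.
  So each part \<open>A\<close> has at least \<open>card A - 1\<close> clients paying
  \<open>r powr l\<close>, and only one client per part is lost, whatever the clustering.\<close>

lemma Psi_ge_of_mostly_far:
  assumes C: "finite C" "partition_on C P"
    and F: "finite F" "card P = card F"
    and r: "0 \<le> r" "0 \<le> l"
    and near: "\<And>f. f \<in> F \<Longrightarrow> \<exists>z. \<forall>x\<in>C. x \<noteq> z \<longrightarrow> r \<le> d x f"
  shows "(real (card C) - real (card P)) * r powr l \<le> Psi d l F P"
proof -
  have P: "finite P" "\<And>A. A \<in> P \<Longrightarrow> finite A" "\<And>A. A \<in> P \<Longrightarrow> A \<subseteq> C"
    using C finite_elements[OF C] by (auto simp: partition_on_def intro: finite_subset)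
  obtain \<pi> where \<pi>: "bij_betw \<pi> P F"
    and Psi: "Psi d l F P = (\<Sum>A\<in>P. \<Sum>x\<in>A. d x (\<pi> A) powr l)"
    using Psi_eqE[OF P(1) F] by blast
  have part: "(real (card A) - 1) * r powr l \<le> (\<Sum>x\<in>A. d x (\<pi> A) powr l)" if A: "A \<in> P" for A
  proof -
    obtain z where z: "\<forall>x\<in>C. x \<noteq> z \<longrightarrow> r \<le> d x (\<pi> A)"
      using near[of "\<pi> A"] \<pi> A by (auto simp: bij_betw_def)
    have "(real (card A) - 1) * r powr l \<le> real (card (A - {z})) * r powr l"
      using P(2)[OF A] by (intro mult_right_mono) (auto simp: card_Diff_singleton_if)
    also have "\<dots> = (\<Sum>x\<in>A - {z}. r powr l)" by simp
    also have "\<dots> \<le> (\<Sum>x\<in>A - {z}. d x (\<pi> A) powr l)"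
      using z P(3)[OF A] r by (intro sum_mono powr_mono2) auto
    also have "\<dots> \<le> (\<Sum>x\<in>A. d x (\<pi> A) powr l)"
      using P(2)[OF A] by (intro sum_mono2) auto
    finally show ?thesis .
  qed
  have "card C = (\<Sum>A\<in>P. card A)"
    using product_partition[OF C(2)] P(2) by blast
  then have "(real (card C) - real (card P)) * r powr l = (\<Sum>A\<in>P. (real (card A) - 1) * r powr l)"
    by (simp add: sum_distrib_right[symmetric] sum_subtractf)
  also have "\<dots> \<le> Psi d l F P"
    unfolding Psi by (intro sum_mono part)
  finally show ?thesis .
qed

text \<open>All bijections cost the same here, so the minimum can be read off any of them.\<close>

lemma Psi_eq_of_equidistant:
  assumes C: "finite C" "partition_on C P"
    and F: "finite F" "card P = card F"
    and eq: "\<And>x f. x \<in> C \<Longrightarrow> f \<in> F \<Longrightarrow> d x f = r"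
  shows "Psi d l F P = real (card C) * r powr l"
proof -
  have P: "finite P" "\<And>A. A \<in> P \<Longrightarrow> finite A" "\<And>A. A \<in> P \<Longrightarrow> A \<subseteq> C"
    using C finite_elements[OF C] by (auto simp: partition_on_def intro: finite_subset)
  obtain \<pi> where \<pi>: "bij_betw \<pi> P F"
    and Psi: "Psi d l F P = (\<Sum>A\<in>P. \<Sum>x\<in>A. d x (\<pi> A) powr l)"
    using Psi_eqE[OF P(1) F] by blast
  have "Psi d l F P = (\<Sum>A\<in>P. real (card A) * r powr l)"
    unfolding Psi
  proof (rule sum.cong[OF refl])
    fix A assume A: "A \<in> P"
    have "d x (\<pi> A) = r" if "x \<in> A" for x
      using eq that P(3)[OF A] \<pi> A by (auto simp: bij_betw_def)
    then show "(\<Sum>x\<in>A. d x (\<pi> A) powr l) = real (card A) * r powr l" by simp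
  qed
  also have "\<dots> = real (\<Sum>A\<in>P. card A) * r powr l"
    by (simp add: sum_distrib_right)
  also have "(\<Sum>A\<in>P. card A) = card C"
    using product_partition[OF C(2)] P(2) by metis
  finally show ?thesis .
qed

text \<open>Serves to show that the optimum is not zero, without which a ratio bound would say
  little.\<close>

lemma Psi_pos:
  assumes C: "finite C" "C \<noteq> {}" "partition_on C P"
    and F: "finite F" "card P = card F"
    and pos: "\<And>x f. x \<in> C \<Longrightarrow> f \<in> F \<Longrightarrow> 0 < d x f"
  shows "0 < Psi d l F P"
proof -
  have P: "finite P" "\<And>A. A \<in> P \<Longrightarrow> finite A" "\<And>A. A \<in> P \<Longrightarrow> A \<noteq> {}" "P \<noteq> {}" "\<Union>P = C"
    using C finite_elements[OF C(1,3)] by (auto simp: partition_on_def intro: finite_subset)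
  obtain \<pi> where \<pi>: "bij_betw \<pi> P F"
    and Psi: "Psi d l F P = (\<Sum>A\<in>P. \<Sum>x\<in>A. d x (\<pi> A) powr l)"
    using Psi_eqE[OF P(1) F] by blast
  have "0 < (\<Sum>x\<in>A. d x (\<pi> A) powr l)" if A: "A \<in> P" for A
  proof (rule sum_pos)
    fix x assume "x \<in> A"
    then have "0 < d x (\<pi> A)"
      using pos[of x "\<pi> A"] P(5) \<pi> A by (auto simp: bij_betw_def)
    then show "0 < d x (\<pi> A) powr l" by simp
  qed (use A P in auto)
  then show ?thesis
    unfolding Psi by (rule sum_pos[OF P(1,4)])
qed

section \<open>Facilities that the algorithm can reach\<close>

text \<open>A chosen point outside \<open>Q\<close> would force all of the strictly closer set
  \<open>Q\<close> into \<open>N\<close>, giving \<open>N\<close> more than \<open>k\<close>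
  elements. Strictness makes the tie-breaking irrelevant.\<close>

lemma k_closest_subset_near:
  assumes "k_closest d L k x N" "finite L" "Q \<subseteq> L" "k \<le> card Q"
    and near: "\<And>a b. a \<in> L - Q \<Longrightarrow> b \<in> Q \<Longrightarrow> d x b < d x a"
  shows "N \<subseteq> Q"
proof
  fix a assume a: "a \<in> N"
  have N: "N \<subseteq> L" "card N = k" "finite N" "\<forall>a\<in>N. \<forall>b\<in>L - N. d x a \<le> d x b"
    using assms(1,2) by (auto simp: k_closest_def center_sets_def intro: finite_subset)
  show "a \<in> Q"
  proof (rule ccontr)
    assume aQ: "a \<notin> Q"
    have "Q \<subseteq> N"
    proof
      fix b assume b: "b \<in> Q"
      show "b \<in> N"
        using near[of a b] N a aQ b \<open>Q \<subseteq> L\<close> by force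
    qed
    then have "Q \<subset> N" using a aQ by blast
    then have "card Q < card N" by (rule psubset_card_mono[OF N(3)])
    then show False using N(2) assms(4) by simp
  qed
qed

lemma set_pmf_D_sampling_subset:
  assumes "finite C" "C \<noteq> {}" "finite F" "F \<noteq> {}"
  shows "set_pmf (D_sampling d l C F) \<subseteq> C"
proof (cases "Phi d l F C = 0")
  case True
  then show ?thesis using assms by (simp add: D_sampling_def set_pmf_of_set)
next
  case False
  then show ?thesis
    using pmf_D_sampling[OF assms(1,3,4) False] by (auto simp: set_pmf_iff split: if_splits)
qed

text \<open>Randomness matters only through its support: samples and initial centers are all
  clients, so every candidate facility is among the \<open>k\<close> closest to some client.\<close>

lemma list_k_service_subset:
  assumes C: "finite C" "C \<noteq> {}" and "0 < k"
    and run: "list_k_service \<alpha> d C L k l \<epsilon> \<L>" and S: "S \<in> \<L>"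
    and closest: "\<And>x N. x \<in> C \<Longrightarrow> k_closest d L k x N \<Longrightarrow> N \<subseteq> Q"
  shows "S \<in> center_sets k Q"
proof -
  obtain F Rs where app: "approx_centers \<alpha> d C k l F"
    and Rs: "\<forall>R\<in>set Rs. round_outcome \<alpha> d C L k l \<epsilon> F R" "\<L> = \<Union>(set Rs)"
    using run unfolding list_k_service_def by blast
  obtain R where R: "round_outcome \<alpha> d C L k l \<epsilon> F R" "S \<in> R"
    using Rs S by blast
  have F: "F \<subseteq> C" "finite F" "F \<noteq> {}"
    using app C \<open>0 < k\<close> by (auto simp: approx_centers_def center_sets_def intro: finite_subset)
  obtain M N where M: "M \<in> set_pmf (map_pmf mset
        (replicate_pmf (nat \<lceil>eta \<alpha> k l \<epsilon> * real k\<rceil>) (D_sampling d l C F)))"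
    and N: "\<forall>x \<in> set_mset M \<union> F. k_closest d L k x (N x)"
    and Req: "R = center_sets k (\<Union>x \<in> set_mset M \<union> F. N x)"
    using R(1) unfolding round_outcome_def by blast
  have "set_mset M \<subseteq> set_pmf (D_sampling d l C F)"
    using M by (auto simp: set_replicate_pmf)
  then have "set_mset M \<union> F \<subseteq> C"
    using set_pmf_D_sampling_subset[OF C F(2,3)] F(1) by blast
  then have "(\<Union>x \<in> set_mset M \<union> F. N x) \<subseteq> Q"
    using N closest by blast
  then show ?thesis
    using R(2) unfolding Req center_sets_def by blast
qed

section \<open>Ingredients of the instance: clustering, metric, small perturbation\<close>

text \<open>Take \<open>k - 1\<close> singletons and one part holding the rest, which is nonempty
  because \<open>k \<le> card C\<close>.\<close>

lemma partition_on_card_exists: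
  assumes "finite C" "1 \<le> k" "k \<le> card C"
  shows "\<exists>P. partition_on C P \<and> card P = k"
proof -
  obtain D where D: "D \<subseteq> C" "card D = k - 1" "finite D"
    by (rule obtain_subset_with_card_n[of "k - 1" C]) (use assms in auto)
  have "\<not> C \<subseteq> D"
    using card_mono[OF D(3), of C] D(2) assms(2,3) by linarith
  then have ne: "C - D \<noteq> {}" by blast
  let ?S = "(\<lambda>x. {x}) ` D"
  have "partition_on C (insert (C - D) ?S)"
    using D ne by (auto simp: partition_on_def disjoint_def)
  moreover have "card (insert (C - D) ?S) = k"
  proof -
    have "C - D \<notin> ?S" using ne by auto
    then show ?thesis using D assms by (simp add: card_image)
  qed
  ultimately show ?thesis by blast
qed

text \<open>A tree metric: points are joined to a common root by arms; \<open>g\<close> is the length of an arm, and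
  \<open>h p\<close> the distance of \<open>p\<close> from the end of its arm.\<close>

definition arm_dist :: "('a \<Rightarrow> 'b) \<Rightarrow> ('b \<Rightarrow> real) \<Rightarrow> ('a \<Rightarrow> real) \<Rightarrow> 'a \<Rightarrow> 'a \<Rightarrow> real" where
  "arm_dist arm g h p q =
     (if p = q then 0
      else h p + h q + (if arm p = arm q then 0 else g (arm p) + g (arm q)))"

text \<open>A detour through \<open>y\<close> never saves an arm length or an \<open>h\<close>.
  Distinct points are apart: by \<open>g\<close> on different arms, by \<open>inj\<close> on the
  same arm.\<close>

lemma Metric_space_arm_dist:
  assumes g: "\<And>a. 0 < g a" and h: "\<And>p. 0 \<le> h p"
    and inj: "\<And>p q. arm p = arm q \<Longrightarrow> h p = 0 \<Longrightarrow> h q = 0 \<Longrightarrow> p = q"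
  shows "Metric_space X (arm_dist arm g h)"
proof
  note gh = g[THEN less_imp_le] h
  fix x y z
  show "0 \<le> arm_dist arm g h x y"
    using gh by (auto simp: arm_dist_def)
  show "arm_dist arm g h x y = arm_dist arm g h y x"
    by (auto simp: arm_dist_def)
  show "arm_dist arm g h x y = 0 \<longleftrightarrow> x = y"
    using inj[of x y] g[of "arm x"] g[of "arm y"] h[of x] h[of y]
    by (auto simp: arm_dist_def add_nonneg_eq_0_iff split: if_splits)
  show "arm_dist arm g h x z \<le> arm_dist arm g h x y + arm_dist arm g h y z"
    using gh(1)[of "arm x"] gh(1)[of "arm y"] gh(1)[of "arm z"] h[of x] h[of y] h[of z]
    by (auto simp: arm_dist_def)
qed

lemma ex_small_perturbation:
  fixes K B l :: real
  assumes "K < B"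
  shows "\<exists>s>0. K * (1 + s) powr l < B"
proof -
  have "((\<lambda>s. K * (1 + s) powr l) \<longlongrightarrow> K * (1 + 0) powr l) (at_right 0)"
    by (intro tendsto_intros) auto
  then have "eventually (\<lambda>s. K * (1 + s) powr l < B) (at_right 0)"
    using assms by (intro order_tendstoD(2)) auto
  moreover have "eventually (\<lambda>s::real. 0 < s) (at_right 0)"
    by (rule eventually_at_right_less)
  ultimately have "eventually (\<lambda>s. 0 < s \<and> K * (1 + s) powr l < B) (at_right 0)"
    by eventually_elim simp
  then show ?thesis
    using eventually_happens by fastforce
qed

theorem theorem4:
  fixes k :: nat and l \<delta>' :: real
  assumes "1 \<le> k" and "1 \<le> l" and "0 < \<delta>'" and "\<delta>' \<le> 1"
  shows "\<exists>(X :: nat set) d C L P.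
           k_service_instance X d C L k l \<and>
           partition_on C P \<and> card P = k \<and>
           0 < Psi_opt d l k L P \<and>
           (\<forall>\<alpha> \<epsilon> \<L>. 1 \<le> \<alpha> \<longrightarrow> 0 < \<epsilon> \<longrightarrow> list_k_service \<alpha> d C L k l \<epsilon> \<L> \<longrightarrow>
              (\<forall>S\<in>\<L>. Psi d l S P \<ge> (3 powr l - \<delta>') * Psi_opt d l k L P))"
proof -
  define K where "K = 3 powr l - \<delta>'"
  have "1 \<le> (3::real) powr l"
    using assms by (intro ge_one_powr_ge_zero) auto
  then have "0 \<le> K" using assms by (simp add: K_def)
  obtain s where s: "0 < s" "K * (1 + s) powr l < 3 powr l"
    using ex_small_perturbation[of K "3 powr l" l] assms by (auto simp: K_def)
  \<comment> \<open>\<open>\<theta>\<close> is the surplus per client of the far cost over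
    \<open>K\<close> times the central cost. \<open>N\<close> is taken so large that the total
    surplus \<open>N * \<theta>\<close> pays for the at most \<open>k\<close> clients served by
    their own facility.\<close>
  define \<theta> where "\<theta> = 3 powr l - K * (1 + s) powr l"
  have "0 < \<theta>" using s by (simp add: \<theta>_def)
  obtain N0 :: nat where N0: "k * 3 powr l / \<theta> \<le> N0"
    using real_arch_simple by blast
  define N where "N = max N0 k"
  have "k * 3 powr l / \<theta> \<le> N" "k \<le> N" using N0 by (auto simp: N_def)
  then have "k * 3 powr l \<le> N * \<theta>"
    using \<open>0 < \<theta>\<close> by (simp add: pos_divide_le_eq)
  then have gap: "K * (N * (1 + s) powr l) \<le> (real N - real k) * 3 powr l"
    by (simp add: \<theta>_def algebra_simps)

  \<comment> \<open>The point \<open>(a, t)\<close> lies on arm \<open>a\<close>. For \<open>a < N\<close> it is a client if \<open>t = 0\<close> and one of the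
    private facilities of that client if \<open>1 \<le> t \<le> k\<close>; the other arms carry the central facilities.\<close>
  define arm where "arm p = fst (prod_decode p)" for p
  define idx where "idx p = snd (prod_decode p)" for p
  define pt where "pt a t = prod_encode (a, t)" for a t
  have [simp]: "arm (pt a t) = a" "idx (pt a t) = t" for a t
    by (simp_all add: arm_def idx_def pt_def)
  have pt_eq_iff: "pt a t = pt a' t' \<longleftrightarrow> a = a' \<and> t = t'" for a t a' t'
    by (simp add: pt_def)
  have pt_eta: "p = pt (arm p) (idx p)" for p
    by (simp add: arm_def idx_def pt_def)
  \<comment> \<open>Arms of clients have length 1, central ones length \<open>s\<close>, and private
    facilities hang 1 beyond the end of their arm. This yields distances 1 to the owner, 1 + 1 + 1 =
    3 to other clients, and 1 + \<open>s\<close> from clients to central facilities.\<close>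
  define d where "d = arm_dist arm (\<lambda>a. if a < N then 1 else s) (\<lambda>p. if idx p = 0 then 0 else 1)"
  define C where "C = (\<lambda>a. pt a 0) ` {..<N}"
  define Priv where "Priv a = pt a ` {1..k}" for a
  define Q where "Q = (\<Union>a<N. Priv a)"
  define Cen where "Cen = (\<lambda>a. pt a 0) ` {N..<N + k}"
  define L where "L = Q \<union> Cen"
  have cardC: "card C = N" and cardCen: "card Cen = k" and cardPriv: "card (Priv a) = k" for a
    by (simp_all add: C_def Cen_def Priv_def card_image inj_on_def pt_eq_iff)
  have fin: "finite C" "finite Cen" "finite Q" "finite L"
    by (auto simp: C_def Cen_def L_def Q_def Priv_def)
  have Cne: "C \<noteq> {}" using cardC \<open>k \<le> N\<close> \<open>1 \<le> k\<close> by auto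
  have Metric: "Metric_space UNIV d"
    unfolding d_def
  proof (rule Metric_space_arm_dist)
    fix p q
    assume arm: "arm p = arm q" and "(if idx p = 0 then 0 else 1) = (0::real)"
      "(if idx q = 0 then 0 else 1) = (0::real)"
    then have "idx p = idx q" by (auto split: if_splits)
    with arm show "p = q" using pt_eta by metis
  qed (use s in auto)
  have d_priv: "d (pt a 0) q = (if a = b then 1 else 3)" if "a < N" "b < N" "q \<in> Priv b" for a b q
    using that by (auto simp: pt_eq_iff d_def arm_dist_def Priv_def)
  have d_Cen: "d x q = 1 + s" if "x \<in> C" "q \<in> Cen" for x q
    using that by (auto simp: pt_eq_iff d_def arm_dist_def C_def Cen_def)
  have inst: "k_service_instance UNIV d C L k l"
    using Metric fin cardC cardCen card_mono[OF fin(4), of Cen] assms \<open>k \<le> N\<close>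
    by (auto simp: k_service_instance_def L_def)
  \<comment> \<open>Any clustering into \<open>k\<close> parts will do: both cost bounds are
    independent of it.\<close>
  obtain P where P: "partition_on C P" "card P = k"
    using partition_on_card_exists[OF fin(1) \<open>1 \<le> k\<close>] cardC \<open>k \<le> N\<close> by blast
  have pos: "0 < d x f" if "x \<in> C" "f \<in> L" for x f
    using that d_Cen[of x f] d_priv s(1) by (auto simp: L_def Q_def C_def)
  have "finite (center_sets k L)" by (rule finite_center_sets[OF fin(4)])
  moreover have Cen_in: "Cen \<in> center_sets k L" using cardCen by (simp add: center_sets_def L_def)
  \<comment> \<open>Comparison with \<open>Cen\<close> bounds the optimum above; its being attained
    gives positivity.\<close>
  ultimately have "Psi_opt d l k L P \<le> Psi d l Cen P"
    and "Psi_opt d l k L P \<in> (\<lambda>F. Psi d l F P) ` center_sets k L"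
    unfolding Psi_opt_def by (auto intro!: Min_le Min_in)
  moreover have "Psi d l Cen P = N * (1 + s) powr l"
    using Psi_eq_of_equidistant[OF fin(1) P(1) fin(2) _ d_Cen] P(2) cardCen cardC by simp
  moreover have "0 < Psi d l F P" if "F \<in> center_sets k L" for F
    using that fin P pos
    by (intro Psi_pos[OF fin(1) Cne P(1)]) (auto simp: center_sets_def intro: finite_subset)
  ultimately have opt: "0 < Psi_opt d l k L P" "Psi_opt d l k L P \<le> N * (1 + s) powr l"
    by auto
  have closest: "M \<subseteq> Q" if x: "x \<in> C" and M: "k_closest d L k x M" for x M
  proof -
    obtain a where a: "a < N" "x = pt a 0" using x by (auto simp: C_def)
    have "M \<subseteq> Priv a"
    proof (rule k_closest_subset_near[OF M fin(4)])
      show "Priv a \<subseteq> L" using a by (auto simp: L_def Q_def)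
      show "k \<le> card (Priv a)" by (simp add: cardPriv)
      fix p q assume p: "p \<in> L - Priv a" and q: "q \<in> Priv a"
      have "d x q = 1" using d_priv[of a a q] a q by simp
      moreover have "1 < d x p"
      proof (cases "p \<in> Cen")
        case True
        then show ?thesis using d_Cen[OF x] s(1) by simp
      next
        case False
        then obtain b where "b < N" "p \<in> Priv b" "b \<noteq> a"
          using p by (auto simp: L_def Q_def)
        then show ?thesis using d_priv[of a b p] a by simp
      qed
      ultimately show "d x q < d x p" by simp
    qed
    then show ?thesis using a by (auto simp: Q_def)
  qed
  have "K * Psi_opt d l k L P \<le> Psi d l S P"
    if run: "list_k_service \<alpha> d C L k l \<epsilon> \<L>" and S: "S \<in> \<L>" for \<alpha> \<epsilon> \<L> S
  proof -
    have "S \<in> center_sets k Q"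
    proof (rule list_k_service_subset[OF fin(1) Cne _ run S])
      show "0 < k" using \<open>1 \<le> k\<close> by simp
    qed (rule closest)
    then have S': "S \<subseteq> Q" "card S = k"
      by (auto simp: center_sets_def)
    then have "finite S"
      using fin(3) finite_subset by blast
    have "\<exists>z. \<forall>x\<in>C. x \<noteq> z \<longrightarrow> 3 \<le> d x f" if f: "f \<in> S" for f
    proof -
      obtain b where b: "b < N" "f \<in> Priv b" using f S'(1) by (auto simp: Q_def)
      \<comment> \<open>The exceptional client is the owner of \<open>f\<close>.\<close>
      have "\<forall>x\<in>C. x \<noteq> pt b 0 \<longrightarrow> 3 \<le> d x f"
        using d_priv[OF _ b] by (auto simp: C_def)
      then show ?thesis by blast
    qed
    then have "(real (card C) - real (card P)) * 3 powr l \<le> Psi d l S P"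
      using Psi_ge_of_mostly_far[OF fin(1) P(1) \<open>finite S\<close>, of 3 l d] S'(2) P(2) \<open>1 \<le> l\<close> by simp
    moreover have "K * Psi_opt d l k L P \<le> K * (N * (1 + s) powr l)"
      using opt(2) \<open>0 \<le> K\<close> by (rule mult_left_mono)
    ultimately show ?thesis using gap unfolding P(2) cardC by linarith
  qed
  then have "\<forall>\<alpha> \<epsilon> \<L>. 1 \<le> \<alpha> \<longrightarrow> 0 < \<epsilon> \<longrightarrow> list_k_service \<alpha> d C L k l \<epsilon> \<L> \<longrightarrow>
      (\<forall>S\<in>\<L>. Psi d l S P \<ge> (3 powr l - \<delta>') * Psi_opt d l k L P)"
    unfolding K_def by blast
  with inst P opt(1) show ?thesis
    by (intro exI conjI)
qed

end
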